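(* Let $X,Y$ be Fréchet spaces, let $\tilde X$ be a closed linear subspace of $X$, and let ${\mathbb A}=((\mathcal A_{j,k})_{k\in\mathbb N})_{1\le j\le N}$ be a sequence of multivalued linear operators $\mathcal A_{j,k}:D(\mathcal A_{j,k})\subseteq X\to Y$. Then: 1. $(d,\tilde X,1)$-distributional chaos of ${\mathbb A}$ implies $(d,\tilde X,i)$-distributional chaos of ${\mathbb A}$ for all $i\in\{1,\dots,12\}$; 2. $(d,\tilde X,2)$-distributional chaos of ${\mathbb A}$ implies $(d,\tilde X,i)$-distributional chaos of ${\mathbb A}$ for all $i\in\{3,4,5,6,10,11,12\}$; 3. $(d,\tilde X,3)$-distributional chaos of ${\mathbb A}$ implies $(d,\tilde X,i)$-distributional chaos of ${\mathbb A}$ for all $i\in\{4,5,10,12\}$; 4. $(d,\tilde X,4)$-distributional chaos of ${\mathbb A}$ implies $(d,\tilde X,12)$-distributional chaos of ${\mathbb A}$; 5. $(d,\tilde X,5)$-distributional chaos of ${\mathbb A}$ implies $(d,\tilde X,10)$-distributional chaos of ${\mathbb A}$; 6. $(d,\tilde X,6)$-distributional chaos of ${\mathbb A}$ implies $(d,\tilde X,i)$-distributional chaos of ${\mathbb A}$ for all $i\in\{4,11,12\}$; 7. $(d,\tilde X,7)$-distributional chaos of ${\mathbb A}$ implies $(d,\tilde X,i)$-distributional chaos of ${\mathbb A}$ for all $i\in\{3,4,5,8,9,10,12\}$; 8. $(d,\tilde X,8)$-distributional chaos of ${\mathbb A}$ implies $(d,\tilde X,i)$-distributional chaos of ${\mathbb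 A}$ for all $i\in\{5,9,10\}$; 9. $(d,\tilde X,9)$-distributional chaos of ${\mathbb A}$ implies $(d,\tilde X,10)$-distributional chaos of ${\mathbb A}$; 10. $(d,\tilde X,10)$-distributional chaos does not in general imply $(d,\tilde X,i)$-distributional chaos for any $i\in\{1,\dots,12\}\setminus\{10\}$ (that is, for each such $i$ there exist Fréchet spaces $X,Y$, a closed linear subspace $\tilde X$ of $X$ and a sequence ${\mathbb A}=((\mathcal A_{j,k})_{k\in\mathbb N})_{1\le j\le N}$ of multivalued linear operators $\mathcal A_{j,k}:D(\mathcal A_{j,k})\subseteq X\to Y$ that is $(d,\tilde X,10)$- but not $(d,\tilde X,i)$-distributionally chaotic); 11. $(d,\tilde X,11)$-distributional chaos of ${\mathbb A}$ implies $(d,\tilde X,12)$-distributional chaos of ${\mathbb A}$; 12. $(d,\tilde X,12)$-distributional chaos does not in general imply $(d,\tilde X,i)$-distributional chaos for any $i\in\{1,\dots,12\}\setminus\{12\}$ (that is, for each such $i$ there exist Fréchet spaces $X,Y$, a closed linear subspace $\tilde X$ of $X$ and a sequence ${\mathbb A}=((\mathcal A_{j,k})_{k\in\mathbb N})_{1\le j\le N}$ of multivalued linear operators $\mathcal A_{j,k}:D(\mathcal A_{j,k})\subseteq X\to Y$ that is $(d,\tilde X,12)$- but not $(d,\tilde X,i)$-distributionally chaotic).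
   Context: $X,Y$ are non-trivial Fréchet spaces over the same field $\mathbb K\in\{\mathbb R,\mathbb C\}$; the topology of $Y$ is induced by an increasing fundamental system of seminorms $(p_n^Y)_{n\in\mathbb N}$ and $d_Y(x,y)=\sum_{n\ge1}2^{-n}\frac{p_n^Y(x-y)}{1+p_n^Y(x-y)}$; if $Y$ is a Banach space, $d_Y(x,y)=\|x-y\|_Y$ instead. $N\ge2$ is a natural number. For $D\subseteq\mathbb N$, $\overline{dens}(D)=\limsup_{n\to\infty}\frac{card(D\cap[1,n])}{n}$. A multivalued linear operator (MLO) $\mathcal A:D(\mathcal A)\subseteq X\to Y$ is a map $\mathcal A:X\to P(Y)$ (power set) such that $D(\mathcal A)=\{x:\mathcal Ax\ne\emptyset\}$ is a linear subspace, $\mathcal Ax+\mathcal Ay\subseteq\mathcal A(x+y)$ and $\lambda\mathcal Ax\subseteq\mathcal A(\lambda x)$ for $x,y\in D(\mathcal A)$, $\lambda\in\mathbb K$. Given $\sigma,\epsilon>0$ and sequences $(x_{j,k})_k,(y_{j,k})_k$ in $Y$ ($1\le j\le N$), put $F_j=\{k\in\mathbb N:d_Y(x_{j,k},y_{j,k})\ge\sigma\}$ and $G_j=\{k\in\mathbb N:d_Y(x_{j,k},y_{j,k})<\epsilon\}$. Let $F_\cap$: $\overline{dens}(\bigcap_{j}F_j)=1$; $F_\cup$: $\overline{dens}(\bigcup_jF_j)=1$; $F_\forall$: $\overline{dens}(F_j)=1$ for all $j$; $F_\exists$: $\overline{dens}(F_j)=1$ for some $j$ (with $1\le j\le N$ throughout);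 and define $G_\cap,G_\cup,G_\forall,G_\exists$ analogously from the sets $G_j$. The twelve conditions $(C_i)$ are: $(C_1)$: $F_\cap$ and $G_\cap$; $(C_2)$: $F_\cap$ and $G_\forall$; $(C_3)$: $F_\forall$ and $G_\forall$; $(C_4)$: $F_\forall$ and $G_\exists$; $(C_5)$: $F_\exists$ and $G_\forall$; $(C_6)$: $F_\cap$ and $G_\exists$; $(C_7)$: $F_\forall$ and $G_\cap$; $(C_8)$: $F_\exists$ and $G_\cap$; $(C_9)$: $F_\cup$ and $G_\cap$; $(C_{10})$: $F_\cup$ and $G_\forall$; $(C_{11})$: $F_\cap$ and $G_\cup$; $(C_{12})$: $F_\forall$ and $G_\cup$. For $i\in\{1,\dots,12\}$, the sequence $((\mathcal A_{j,k})_{k\in\mathbb N})_{1\le j\le N}$ of MLOs is called $(d,\tilde X,i)$-distributionally chaotic iff there exist an uncountable set $S\subseteq\bigcap_{j=1}^N\bigcap_{k=1}^\infty D(\mathcal A_{j,k})\cap\tilde X$ and $\sigma>0$ such that for each $\epsilon>0$ and each pair $x,y\in S$ of distinct points there exist elements $x_{j,k}\in\mathcal A_{j,k}x$ and $y_{j,k}\in\mathcal A_{j,k}y$ ($1\le j\le N$, $k\in\mathbb N$) such that $(C_i)$ holds. *)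

theory Defs
  imports "HOL-Analysis.Analysis" "HOL-Algebra.Module"
begin

text \<open>The scalar field is a subset \<open>K\<close> of the complex numbers, which in the theorem is either
  \<open>\<real>\<close> or \<open>UNIV\<close>. This treats real and complex spaces uniformly.\<close>

definition scalars :: "complex set \<Rightarrow> complex ring" where
  "scalars K = \<lparr>carrier = K, mult = (*), one = 1, zero = 0, add = (+)\<rparr>"

text \<open>A space carries its vector space structure (a module over \<open>scalars K\<close>; the fields \<open>mult\<close>
  and \<open>one\<close> inherited from the record \<open>ring\<close> are irrelevant) and its topology.
  It is based on an explicit carrier, so that one can quantify over spaces inside a formula.\<close>

record 'a tvs = "(complex, 'a) module" +
  topol :: "'a topology"

definition seminorm_on :: "complex set \<Rightarrow> 'a tvs \<Rightarrow> ('a \<Rightarrow> real) \<Rightarrow> bool" where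
  "seminorm_on K X p \<longleftrightarrow>
     (\<forall>x\<in>carrier X. 0 \<le> p x) \<and>
     (\<forall>x\<in>carrier X. \<forall>y\<in>carrier X. p (x \<oplus>\<^bsub>X\<^esub> y) \<le> p x + p y) \<and>
     (\<forall>c\<in>K. \<forall>x\<in>carrier X. p (c \<odot>\<^bsub>X\<^esub> x) = cmod c * p x)"

text \<open>The family \<open>p\<close> is assumed increasing wherever the following notion is used, so single balls
  form a neighbourhood base.\<close>

definition induces_topology :: "'a tvs \<Rightarrow> (nat \<Rightarrow> 'a \<Rightarrow> real) \<Rightarrow> bool" where
  "induces_topology X p \<longleftrightarrow>
     (\<forall>U. openin (topol X) U \<longleftrightarrow>
        U \<subseteq> carrier X \<and>
        (\<forall>x\<in>U. \<exists>n. \<exists>r>0. {y \<in> carrier X. p n (y \<ominus>\<^bsub>X\<^esub> x) < r} \<subseteq> U))"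

text \<open>Seminorms are indexed from \<open>0\<close>: \<open>p n\<close> is the \<open>(n + 1)\<close>-st seminorm of the system.\<close>

definition fundamental_system :: "complex set \<Rightarrow> 'a tvs \<Rightarrow> (nat \<Rightarrow> 'a \<Rightarrow> real) \<Rightarrow> bool" where
  "fundamental_system K X p \<longleftrightarrow>
     (\<forall>n. seminorm_on K X (p n)) \<and>
     (\<forall>n. \<forall>x\<in>carrier X. p n x \<le> p (Suc n) x) \<and>
     induces_topology X p"

definition separating :: "'a tvs \<Rightarrow> (nat \<Rightarrow> 'a \<Rightarrow> real) \<Rightarrow> bool" where
  "separating X p \<longleftrightarrow> (\<forall>x\<in>carrier X. (\<forall>n. p n x = 0) \<longrightarrow> x = \<zero>\<^bsub>X\<^esub>)"

definition complete_wrt :: "'a tvs \<Rightarrow> (nat \<Rightarrow> 'a \<Rightarrow> real) \<Rightarrow> bool" where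
  "complete_wrt X p \<longleftrightarrow>
     (\<forall>s. (\<forall>i. s i \<in> carrier X) \<and>
          (\<forall>n. \<forall>e>0. \<exists>M. \<forall>i\<ge>M. \<forall>j\<ge>M. p n (s i \<ominus>\<^bsub>X\<^esub> s j) < e) \<longrightarrow>
        (\<exists>l\<in>carrier X. \<forall>n. (\<lambda>i. p n (s i \<ominus>\<^bsub>X\<^esub> l)) \<longlonglongrightarrow> 0))"

definition frechet_space :: "complex set \<Rightarrow> 'a tvs \<Rightarrow> bool" where
  "frechet_space K X \<longleftrightarrow>
     Module.module (scalars K) X \<and>
     (\<exists>p. fundamental_system K X p \<and> separating X p \<and> complete_wrt X p)"

definition banach_norm :: "complex set \<Rightarrow> 'a tvs \<Rightarrow> ('a \<Rightarrow> real) \<Rightarrow> bool" where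
  "banach_norm K X q \<longleftrightarrow>
     seminorm_on K X q \<and> (\<forall>x\<in>carrier X. q x = 0 \<longrightarrow> x = \<zero>\<^bsub>X\<^esub>) \<and>
     induces_topology X (\<lambda>_. q) \<and> complete_wrt X (\<lambda>_. q)"

text \<open>\<open>d\<close> is an admissible choice of the distance of \<open>Y\<close>: the norm distance if \<open>Y\<close> is a Banach
  space, and otherwise the distance given by an increasing fundamental system of seminorms.\<close>

definition space_dist :: "complex set \<Rightarrow> 'b tvs \<Rightarrow> ('b \<Rightarrow> 'b \<Rightarrow> real) \<Rightarrow> bool" where
  "space_dist K Y d \<longleftrightarrow>
     (if \<exists>q. banach_norm K Y q
      then \<exists>q. banach_norm K Y q \<and>
             (\<forall>x\<in>carrier Y. \<forall>y\<in>carrier Y. d x y = q (x \<ominus>\<^bsub>Y\<^esub> y))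
      else \<exists>p. fundamental_system K Y p \<and>
             (\<forall>x\<in>carrier Y. \<forall>y\<in>carrier Y.
                d x y = (\<Sum>n. (1/2) ^ Suc n * (p n (x \<ominus>\<^bsub>Y\<^esub> y) / (1 + p n (x \<ominus>\<^bsub>Y\<^esub> y))))))"

definition mlo_dom :: "'a tvs \<Rightarrow> ('a \<Rightarrow> 'b set) \<Rightarrow> 'a set" where
  "mlo_dom X A = {x \<in> carrier X. A x \<noteq> {}}"

definition mlo :: "complex set \<Rightarrow> 'a tvs \<Rightarrow> 'b tvs \<Rightarrow> ('a \<Rightarrow> 'b set) \<Rightarrow> bool" where
  "mlo K X Y A \<longleftrightarrow>
     (\<forall>x\<in>carrier X. A x \<subseteq> carrier Y) \<and>
     submodule (mlo_dom X A) (scalars K) X \<and>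
     (\<forall>x\<in>mlo_dom X A. \<forall>y\<in>mlo_dom X A. {u \<oplus>\<^bsub>Y\<^esub> v |u v. u \<in> A x \<and> v \<in> A y} \<subseteq> A (x \<oplus>\<^bsub>X\<^esub> y)) \<and>
     (\<forall>c\<in>K. \<forall>x\<in>mlo_dom X A. (\<lambda>u. c \<odot>\<^bsub>Y\<^esub> u) ` A x \<subseteq> A (c \<odot>\<^bsub>X\<^esub> x))"

text \<open>Natural numbers start at \<open>1\<close>, so sequence indices are restricted to \<open>k \<ge> 1\<close>.
  The quotient at \<open>n = 0\<close> does not affect the limit superior.\<close>

definition upper_dens :: "nat set \<Rightarrow> ereal" where
  "upper_dens D = limsup (\<lambda>n. ereal (real (card (D \<inter> {1..n})) / real n))"

definition dens_inter :: "nat \<Rightarrow> (nat \<Rightarrow> nat set) \<Rightarrow> bool" where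
  "dens_inter N D \<longleftrightarrow> upper_dens (\<Inter>j\<in>{1..N}. D j) = 1"

definition dens_union :: "nat \<Rightarrow> (nat \<Rightarrow> nat set) \<Rightarrow> bool" where
  "dens_union N D \<longleftrightarrow> upper_dens (\<Union>j\<in>{1..N}. D j) = 1"

definition dens_all :: "nat \<Rightarrow> (nat \<Rightarrow> nat set) \<Rightarrow> bool" where
  "dens_all N D \<longleftrightarrow> (\<forall>j\<in>{1..N}. upper_dens (D j) = 1)"

definition dens_ex :: "nat \<Rightarrow> (nat \<Rightarrow> nat set) \<Rightarrow> bool" where
  "dens_ex N D \<longleftrightarrow> (\<exists>j\<in>{1..N}. upper_dens (D j) = 1)"

definition chaos_cond :: "nat \<Rightarrow> nat \<Rightarrow> (nat \<Rightarrow> nat set) \<Rightarrow> (nat \<Rightarrow> nat set) \<Rightarrow> bool" where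
  "chaos_cond i N F G \<longleftrightarrow>
     i = 1 \<and> dens_inter N F \<and> dens_inter N G \<or>
     i = 2 \<and> dens_inter N F \<and> dens_all N G \<or>
     i = 3 \<and> dens_all N F \<and> dens_all N G \<or>
     i = 4 \<and> dens_all N F \<and> dens_ex N G \<or>
     i = 5 \<and> dens_ex N F \<and> dens_all N G \<or>
     i = 6 \<and> dens_inter N F \<and> dens_ex N G \<or>
     i = 7 \<and> dens_all N F \<and> dens_inter N G \<or>
     i = 8 \<and> dens_ex N F \<and> dens_inter N G \<or>
     i = 9 \<and> dens_union N F \<and> dens_inter N G \<or>
     i = 10 \<and> dens_union N F \<and> dens_all N G \<or>
     i = 11 \<and> dens_inter N F \<and> dens_union N G \<or>
     i = 12 \<and> dens_all N F \<and> dens_union N G"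

text \<open>In the families below, \<open>A j k\<close> and \<open>xs j k\<close> are only relevant for
  \<open>1 \<le> j \<le> N\<close> and \<open>k \<ge> 1\<close>.\<close>

definition dist_chaotic ::
  "nat \<Rightarrow> 'a tvs \<Rightarrow> ('b \<Rightarrow> 'b \<Rightarrow> real) \<Rightarrow> 'a set \<Rightarrow> nat \<Rightarrow> (nat \<Rightarrow> nat \<Rightarrow> 'a \<Rightarrow> 'b set) \<Rightarrow> bool" where
  "dist_chaotic N X d Xt i A \<longleftrightarrow>
     (\<exists>S \<sigma>. uncountable S \<and> S \<subseteq> (\<Inter>j\<in>{1..N}. \<Inter>k\<in>{1..}. mlo_dom X (A j k)) \<inter> Xt \<and> (0::real) < \<sigma> \<and>
       (\<forall>\<epsilon>>0. \<forall>x\<in>S. \<forall>y\<in>S. x \<noteq> y \<longrightarrow>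
         (\<exists>xs ys. (\<forall>j\<in>{1..N}. \<forall>k\<ge>1. xs j k \<in> A j k x \<and> ys j k \<in> A j k y) \<and>
            chaos_cond i N
              (\<lambda>j. {k. k \<ge> 1 \<and> d (xs j k) (ys j k) \<ge> \<sigma>})
              (\<lambda>j. {k. k \<ge> 1 \<and> d (xs j k) (ys j k) < \<epsilon>}))))"

definition mlo_setting ::
  "complex set \<Rightarrow> nat \<Rightarrow> 'a tvs \<Rightarrow> 'b tvs \<Rightarrow> ('b \<Rightarrow> 'b \<Rightarrow> real) \<Rightarrow> 'a set \<Rightarrow>
     (nat \<Rightarrow> nat \<Rightarrow> 'a \<Rightarrow> 'b set) \<Rightarrow> bool" where
  "mlo_setting K N X Y d Xt A \<longleftrightarrow>
     frechet_space K X \<and> carrier X \<noteq> {\<zero>\<^bsub>X\<^esub>} \<and>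
     frechet_space K Y \<and> carrier Y \<noteq> {\<zero>\<^bsub>Y\<^esub>} \<and>
     space_dist K Y d \<and>
     submodule Xt (scalars K) X \<and> closedin (topol X) Xt \<and>
     (\<forall>j\<in>{1..N}. \<forall>k\<ge>1. mlo K X Y (A j k))"

end

theory Submission
  imports Defs
begin

text \<open>
  \<^bold>\<open>Implications.\<close> An upper density never exceeds \<open>1\<close>, so having upper density \<open>1\<close> is
  inherited by larger sets. Hence, for a nonempty index range, ``intersection'' implies ``all'',
  which implies ``some'', which implies ``union''. Each claimed implication weakens the
  condition on the sets \<open>F j\<close> or on the sets \<open>G j\<close> in this order, and the same set of
  points, the same threshold and the same selections still witness chaos
  (\<open>dist_chaotic_weaken\<close>).

  \<^bold>\<open>Non-implications.\<close> Already multiplications by scalars on the line \<open>X = Y = K\<close> suffice. Given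
  sets \<open>E j\<close> of positive integers, let the \<open>k\<close>-th operator of the \<open>j\<close>-th sequence be
  multiplication by \<open>k\<close> if \<open>k \<in> E j\<close>, and by \<open>0\<close> otherwise. Two distinct points are then driven
  arbitrarily far apart along \<open>E j\<close> and are merged off \<open>E j\<close>. Up to finite sets, which upper
  densities ignore, \<open>F j\<close> is \<open>E j\<close> and \<open>G j\<close> is the complement of \<open>E j\<close>. So chaos of type \<open>i\<close>
  is a purely combinatorial property of \<open>E\<close> (\<open>dist_chaotic_scaling_iff\<close>).

  Type 10 is separated from every other type once the union of the \<open>E j\<close> and all complements
  \<open>- E j\<close> have upper density \<open>1\<close>, while no \<open>E j\<close> and not the intersection of the complements do;
  type 12 is separated by the complementary family. To find such sets, group the integers into
  pairs \<open>{2 * m, 2 * m + 1}\<close> and split the pairs into ever longer blocks of three alternating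
  phases. In phase 0 the odd numbers go to \<open>E 1\<close> and the even ones to \<open>E 2\<close>, so the union is
  everything; in phase 1 only the even numbers are used, for \<open>E 2\<close>; in phase 2 only the odd
  ones, for \<open>E 1\<close>. The remaining sets are empty. The blocks grow so fast that each phase has
  upper density \<open>1\<close>, which gives the two positive requirements. On the other hand \<open>E 1\<close>, \<open>E 2\<close>
  and the complement of the union each contain at most one member of every pair, so their upper
  density is at most one half.
\<close>

section \<open>Upper density\<close>

lemma upper_dens_mono:
  assumes "A \<subseteq> B"
  shows "upper_dens A \<le> upper_dens B"
  unfolding upper_dens_def
proof (intro Limsup_mono always_eventually allI)
  fix n
  have "card (A \<inter> {1..n}) \<le> card (B \<inter> {1..n})"
    using assms by (intro card_mono) auto
  then show "ereal (real (card (A \<inter> {1..n})) / real n) \<le> ereal (real (card (B \<inter> {1..n})) / real n)"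
    by (simp add: divide_right_mono)
qed

lemma upper_dens_le_1: "upper_dens A \<le> 1"
  unfolding upper_dens_def
proof (intro Limsup_bounded always_eventually allI)
  fix n
  have "card (A \<inter> {1..n}) \<le> card {1..n}"
    by (intro card_mono) auto
  then show "ereal (real (card (A \<inter> {1..n})) / real n) \<le> 1"
    by (auto simp: divide_le_eq_1)
qed

lemma upper_dens_1_mono:
  assumes "upper_dens A = 1" and "A \<subseteq> B"
  shows "upper_dens B = 1"
  using upper_dens_mono[OF assms(2)] upper_dens_le_1[of B] assms(1) by simp

lemma upper_dens_atLeast: "upper_dens (A \<inter> {m..}) = upper_dens A"
proof (rule antisym)
  show "upper_dens (A \<inter> {m..}) \<le> upper_dens A"
    by (rule upper_dens_mono) auto
  let ?u = "\<lambda>n. ereal (real (card (A \<inter> {m..} \<inter> {1..n})) / real n)"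
  have lim: "(\<lambda>n. ereal (real m / real n)) \<longlonglongrightarrow> 0"
    using lim_const_over_n[of "real m"] by (simp add: zero_ereal_def)
  have "upper_dens A \<le> limsup (\<lambda>n. ereal (real m / real n) + ?u n)"
    unfolding upper_dens_def
  proof (intro Limsup_mono always_eventually allI)
    fix n
    have "card (A \<inter> {1..n}) \<le> card ({..<m} \<union> (A \<inter> {m..} \<inter> {1..n}))"
      by (intro card_mono) auto
    also have "\<dots> \<le> m + card (A \<inter> {m..} \<inter> {1..n})"
      using card_Un_le[of "{..<m}" "A \<inter> {m..} \<inter> {1..n}"] by simp
    finally have "real (card (A \<inter> {1..n})) \<le> real m + real (card (A \<inter> {m..} \<inter> {1..n}))"
      by linarith
    then show "ereal (real (card (A \<inter> {1..n})) / real n) \<le> ereal (real m / real n) + ?u n"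
      by (simp add: add_divide_distrib[symmetric] divide_right_mono)
  qed
  also have "\<dots> = 0 + limsup ?u"
    by (rule ereal_limsup_lim_add[OF lim]) simp
  finally show "upper_dens A \<le> upper_dens (A \<inter> {m..})"
    by (simp add: upper_dens_def)
qed

text \<open>On such a set \<open>k \<mapsto> k div 2\<close> is injective, so at most about half of the first \<open>n\<close> integers
  belong to it.\<close>

lemma upper_dens_le_half:
  assumes pair: "\<And>m. \<not> (2 * m \<in> A \<and> 2 * m + 1 \<in> A)"
  shows "upper_dens A \<le> ereal (1/2)"
proof -
  have inj: "inj_on (\<lambda>k. k div 2) A"
  proof (rule inj_onI)
    fix k l assume kl: "k \<in> A" "l \<in> A" "k div 2 = l div 2"
    then have "k = 2 * (k div 2) \<or> k = 2 * (k div 2) + 1" "l = 2 * (k div 2) \<or> l = 2 * (k div 2) + 1"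
      by presburger+
    then show "k = l"
      using pair[of "k div 2"] kl by metis
  qed
  have "upper_dens A \<le> limsup (\<lambda>n. ereal (1/2 + 1 / real n))"
    unfolding upper_dens_def
  proof (intro Limsup_mono)
    show "\<forall>\<^sub>F n in sequentially.
      ereal (real (card (A \<inter> {1..n})) / real n) \<le> ereal (1/2 + 1 / real n)"
      using eventually_gt_at_top[of 0]
    proof eventually_elim
      case (elim n)
      have "card (A \<inter> {1..n}) = card ((\<lambda>k. k div 2) ` (A \<inter> {1..n}))"
        by (rule card_image[symmetric], rule inj_on_subset[OF inj]) auto
      also have "\<dots> \<le> card {0..n div 2}"
        by (intro card_mono) (auto intro: div_le_mono)
      finally have "real (card (A \<inter> {1..n})) \<le> real n / 2 + 1"
        by simp
      then show ?case
        using elim by (simp add: field_simps)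
    qed
  qed
  also have "(\<lambda>n. ereal (1/2 + 1 / real n)) \<longlonglongrightarrow> ereal (1/2)"
    using tendsto_add[OF tendsto_const lim_const_over_n[of 1], of "1/2"] by simp
  then have "limsup (\<lambda>n. ereal (1/2 + 1 / real n)) = ereal (1/2)"
    by (intro lim_imp_Limsup) auto
  finally show ?thesis .
qed

text \<open>A block fills all but the fraction \<open>1 / (n + 1)\<close> of the initial segment that ends with it.\<close>

lemma upper_dens_fact_blocks:
  assumes "\<exists>\<^sub>F n in sequentially. {2 * fact n..<2 * fact (Suc n)} \<subseteq> A"
  shows "upper_dens A = 1"
proof (rule antisym[OF upper_dens_le_1], rule ccontr)
  let ?u = "\<lambda>n. ereal (real (card (A \<inter> {1..n})) / real n)"
  assume "\<not> 1 \<le> upper_dens A"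
  then have "upper_dens A < 1"
    by (simp only: not_le)
  from ereal_dense2[OF this] obtain c where c: "upper_dens A < ereal c" "ereal c < 1"
    by (elim exE conjE) (rule that)
  then have "\<forall>\<^sub>F n in sequentially. ?u n < ereal c"
    unfolding upper_dens_def by (intro Limsup_lessD) auto
  moreover have "filterlim (\<lambda>n. 2 * fact (Suc n) :: nat) at_top sequentially"
  proof (rule filterlim_at_top_mono[OF filterlim_ident], rule always_eventually, rule allI)
    fix n :: nat
    show "n \<le> 2 * fact (Suc n)"
      using fact_ge_self[of "Suc n"] by linarith
  qed
  ultimately have "\<forall>\<^sub>F n in sequentially. ?u (2 * fact (Suc n)) < ereal c"
    by (rule eventually_compose_filterlim)
  moreover have "(\<lambda>n. 1 - 1 / real (Suc n)) \<longlonglongrightarrow> 1"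
    using tendsto_diff[OF tendsto_const LIMSEQ_Suc[OF lim_const_over_n[of 1]], of 1] by simp
  then have "\<forall>\<^sub>F n in sequentially. c < 1 - 1 / real (Suc n)"
    using c(2) by (intro order_tendstoD) (auto simp: one_ereal_def)
  ultimately have "\<forall>\<^sub>F n in sequentially. \<not> {2 * fact n..<2 * fact (Suc n)} \<subseteq> A"
  proof eventually_elim
    case (elim n)
    show ?case
    proof
      assume block: "{2 * fact n..<2 * fact (Suc n)} \<subseteq> A"
      define a b :: nat where "a = 2 * fact n" and "b = 2 * fact (Suc n)"
      have "a \<ge> 1"
        by (simp add: a_def)
      then have "card {a..<b} \<le> card (A \<inter> {1..b})"
        using block[folded a_def b_def] by (intro card_mono) auto
      then have "b \<le> card (A \<inter> {1..b}) + a"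
        by simp
      then have "real b \<le> real (card (A \<inter> {1..b})) + real a"
        by linarith
      then have "(real b - real a) / real b \<le> real (card (A \<inter> {1..b})) / real b"
        by (intro divide_right_mono) auto
      moreover have "real b = real (Suc n) * real a"
        by (simp add: a_def b_def algebra_simps)
      then have "(real b - real a) / real b = 1 - 1 / real (Suc n)"
        using \<open>a \<ge> 1\<close> by (simp add: diff_divide_distrib del: of_nat_Suc)
      ultimately show False
        using elim unfolding b_def[symmetric] less_ereal.simps by linarith
    qed
  qed
  with assms show False
    by (simp add: frequently_def)
qed

section \<open>Monotonicity of the chaos conditions\<close>

lemma dens_inter_imp_all: "dens_inter N D \<Longrightarrow> dens_all N D"
  unfolding dens_inter_def dens_all_def by (blast intro: upper_dens_1_mono)

lemma dens_all_imp_ex: "1 \<le> N \<Longrightarrow> dens_all N D \<Longrightarrow> dens_ex N D"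
  unfolding dens_all_def dens_ex_def by auto

lemma dens_ex_imp_union: "dens_ex N D \<Longrightarrow> dens_union N D"
  unfolding dens_ex_def dens_union_def by (blast intro: upper_dens_1_mono)

lemmas dens_imps = dens_inter_imp_all dens_all_imp_ex dens_ex_imp_union

lemma dens_mono:
  assumes "\<And>j. j \<in> {1..N} \<Longrightarrow> D j \<subseteq> D' j"
  shows "dens_inter N D \<Longrightarrow> dens_inter N D'" "dens_all N D \<Longrightarrow> dens_all N D'"
    and "dens_ex N D \<Longrightarrow> dens_ex N D'" "dens_union N D \<Longrightarrow> dens_union N D'"
proof -
  show "dens_inter N D \<Longrightarrow> dens_inter N D'"
    unfolding dens_inter_def by (erule upper_dens_1_mono) (use assms in blast)
  show "dens_union N D \<Longrightarrow> dens_union N D'"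
    unfolding dens_union_def by (erule upper_dens_1_mono) (use assms in blast)
  show "dens_all N D \<Longrightarrow> dens_all N D'" "dens_ex N D \<Longrightarrow> dens_ex N D'"
    unfolding dens_all_def dens_ex_def using assms upper_dens_1_mono by blast+
qed

lemma chaos_cond_mono:
  assumes "chaos_cond i N F G"
    and "\<And>j. j \<in> {1..N} \<Longrightarrow> F j \<subseteq> F' j" and "\<And>j. j \<in> {1..N} \<Longrightarrow> G j \<subseteq> G' j"
  shows "chaos_cond i N F' G'"
proof -
  have "dens_inter N F \<longrightarrow> dens_inter N F'" "dens_all N F \<longrightarrow> dens_all N F'"
    "dens_ex N F \<longrightarrow> dens_ex N F'" "dens_union N F \<longrightarrow> dens_union N F'"
    "dens_inter N G \<longrightarrow> dens_inter N G'" "dens_all N G \<longrightarrow> dens_all N G'"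
    "dens_ex N G \<longrightarrow> dens_ex N G'" "dens_union N G \<longrightarrow> dens_union N G'"
    using dens_mono assms(2,3) by (metis (no_types, lifting))+
  then show ?thesis
    using assms(1) unfolding chaos_cond_def by argo
qed

lemma dens_atLeast:
  assumes "1 \<le> N"
  shows "dens_inter N (\<lambda>j. D j \<inter> {m..}) \<longleftrightarrow> dens_inter N D"
    and "dens_all N (\<lambda>j. D j \<inter> {m..}) \<longleftrightarrow> dens_all N D"
    and "dens_ex N (\<lambda>j. D j \<inter> {m..}) \<longleftrightarrow> dens_ex N D"
    and "dens_union N (\<lambda>j. D j \<inter> {m..}) \<longleftrightarrow> dens_union N D"
proof -
  have "(\<Inter>j\<in>{1..N}. D j \<inter> {m..}) = (\<Inter>j\<in>{1..N}. D j) \<inter> {m..}"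
    using assms by auto
  then show "dens_inter N (\<lambda>j. D j \<inter> {m..}) \<longleftrightarrow> dens_inter N D"
    by (simp only: dens_inter_def upper_dens_atLeast)
  have "(\<Union>j\<in>{1..N}. D j \<inter> {m..}) = (\<Union>j\<in>{1..N}. D j) \<inter> {m..}"
    by auto
  then show "dens_union N (\<lambda>j. D j \<inter> {m..}) \<longleftrightarrow> dens_union N D"
    by (simp only: dens_union_def upper_dens_atLeast)
qed (simp_all add: dens_all_def dens_ex_def upper_dens_atLeast)

lemma chaos_cond_atLeast:
  assumes "1 \<le> N"
  shows "chaos_cond i N (\<lambda>j. F j \<inter> {m..}) (\<lambda>j. G j \<inter> {m..}) \<longleftrightarrow> chaos_cond i N F G"
  unfolding chaos_cond_def by (simp only: dens_atLeast[OF assms])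

lemma dist_chaotic_weaken:
  assumes "dist_chaotic N X d Xt i A"
    and "\<And>F G. chaos_cond i N F G \<Longrightarrow> chaos_cond i' N F G"
  shows "dist_chaotic N X d Xt i' A"
  using assms(1) unfolding dist_chaotic_def Ball_def
  by (elim ex_forward conj_forward all_forward imp_forward) (assumption | rule assms(2))+

section \<open>Scalar multiplications on the line\<close>

definition line :: "complex set \<Rightarrow> complex tvs" where
  "line K = \<lparr>carrier = K, mult = (*), one = 1, zero = 0, add = (+), smult = (*),
     topol = top_of_set K\<rparr>"

text \<open>Both admissible scalar fields are closed subrings of \<open>\<complex>\<close> that contain \<open>\<real>\<close>: closedness
  gives completeness of the line, and the copy of \<open>\<real>\<close> makes it uncountable.\<close>

locale scalar_field =
  fixes K :: "complex set"
  assumes K: "K = \<real> \<or> K = UNIV"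
begin

lemma K_closed:
  shows "0 \<in> K" "1 \<in> K" "of_nat n \<in> K" "x \<in> K \<Longrightarrow> - x \<in> K"
    and "x \<in> K \<Longrightarrow> y \<in> K \<Longrightarrow> x + y \<in> K" "x \<in> K \<Longrightarrow> y \<in> K \<Longrightarrow> x - y \<in> K"
    and "x \<in> K \<Longrightarrow> y \<in> K \<Longrightarrow> x * y \<in> K"
  using K by auto

lemma closed_K: "closed K"
  using K closed_complex_Reals by auto

lemma uncountable_K: "uncountable K"
proof
  assume "countable K"
  then have "countable (range complex_of_real)"
    using K countable_subset[of "range complex_of_real" K] by (auto simp: Reals_def)
  then have "countable (UNIV :: real set)"
    by (rule countable_image_inj_on) (auto intro: injI)
  then show False
    using uncountable_UNIV_real by simp
qed

lemma line_simps:
  shows "carrier (line K) = K" "zero (line K) = 0" "add (line K) = (+)" "smult (line K) = (*)"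
    and "topol (line K) = top_of_set K"
  by (simp_all add: line_def)

lemma scalars_simps:
  shows "carrier (scalars K) = K" "zero (scalars K) = 0" "one (scalars K) = 1"
    and "add (scalars K) = (+)" "mult (scalars K) = (*)"
  by (simp_all add: scalars_def)

lemma cring_scalars: "cring (scalars K)"
proof (rule cringI)
  show "abelian_group (scalars K)"
  proof (rule abelian_groupI)
    fix x assume "x \<in> carrier (scalars K)"
    then show "\<exists>y\<in>carrier (scalars K). y \<oplus>\<^bsub>scalars K\<^esub> x = \<zero>\<^bsub>scalars K\<^esub>"
      by (intro bexI[of _ "- x"]) (auto simp: scalars_simps K_closed)
  qed (auto simp: scalars_simps K_closed)
  show "comm_monoid (scalars K)"
    by (rule comm_monoidI) (auto simp: scalars_simps K_closed)
qed (auto simp: scalars_simps algebra_simps)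

lemma abelian_group_line: "abelian_group (line K)"
proof (rule abelian_groupI)
  fix x assume "x \<in> carrier (line K)"
  then show "\<exists>y\<in>carrier (line K). y \<oplus>\<^bsub>line K\<^esub> x = \<zero>\<^bsub>line K\<^esub>"
    by (intro bexI[of _ "- x"]) (auto simp: line_simps K_closed)
qed (auto simp: line_simps K_closed)

lemma module_line: "Module.module (scalars K) (line K)"
  by (rule module.intro[OF cring_scalars abelian_group_line])
    (unfold_locales, auto simp: line_simps scalars_simps K_closed algebra_simps)

lemma line_minus:
  assumes "x \<in> K" "y \<in> K"
  shows "x \<ominus>\<^bsub>line K\<^esub> y = x - y"
proof -
  have "\<ominus>\<^bsub>line K\<^esub> y = - y"
    using assms by (intro abelian_group.minus_equality[OF abelian_group_line])
      (auto simp: line_simps K_closed)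
  then show ?thesis
    by (simp add: a_minus_def line_simps)
qed

lemma seminorm_cmod: "seminorm_on K (line K) cmod"
  by (auto simp: seminorm_on_def line_simps norm_triangle_ineq norm_mult)

lemma induces_topology_cmod: "induces_topology (line K) (\<lambda>_. cmod)"
  unfolding induces_topology_def
proof (intro allI)
  fix U
  have ball: "{y \<in> K. cmod (y \<ominus>\<^bsub>line K\<^esub> x) < r} \<subseteq> U \<longleftrightarrow> (\<forall>y\<in>K. dist y x < r \<longrightarrow> y \<in> U)"
    if "x \<in> K" for x r
    using that by (auto simp: line_minus dist_norm)
  have "openin (top_of_set K) U \<longleftrightarrow>
      U \<subseteq> K \<and> (\<forall>x\<in>U. \<exists>r>0. \<forall>y\<in>K. dist y x < r \<longrightarrow> y \<in> U)"
    by (rule openin_euclidean_subtopology_iff)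
  also have "\<dots> \<longleftrightarrow> U \<subseteq> carrier (line K) \<and> (\<forall>x\<in>U. \<exists>n::nat. \<exists>r>0.
      {y \<in> carrier (line K). cmod (y \<ominus>\<^bsub>line K\<^esub> x) < r} \<subseteq> U)"
    unfolding line_simps using ball by (intro conj_cong refl ball_cong) (simp add: subsetD)
  finally show "openin (topol (line K)) U \<longleftrightarrow> U \<subseteq> carrier (line K) \<and> (\<forall>x\<in>U. \<exists>n::nat. \<exists>r>0.
      {y \<in> carrier (line K). cmod (y \<ominus>\<^bsub>line K\<^esub> x) < r} \<subseteq> U)"
    by (simp only: line_simps)
qed

lemma complete_cmod: "complete_wrt (line K) (\<lambda>_. cmod)"
  unfolding complete_wrt_def
proof (intro allI impI)
  fix s :: "nat \<Rightarrow> complex"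
  assume s: "(\<forall>i. s i \<in> carrier (line K)) \<and>
    (\<forall>n::nat. \<forall>e>0. \<exists>M. \<forall>i\<ge>M. \<forall>j\<ge>M. cmod (s i \<ominus>\<^bsub>line K\<^esub> s j) < e)"
  then have sK: "\<And>i. s i \<in> K"
    by (simp add: line_simps)
  have "Cauchy s"
    unfolding Cauchy_def dist_norm using s sK by (simp add: line_minus)
  then obtain l where l: "s \<longlonglongrightarrow> l"
    by (auto simp: Cauchy_convergent_iff convergent_def)
  then have lK: "l \<in> K"
    using closed_K sK by (auto simp: closed_sequential_limits)
  have "(\<lambda>i. cmod (s i - l)) \<longlonglongrightarrow> 0"
    using l by (simp add: LIM_zero tendsto_norm_zero)
  then show "\<exists>l\<in>carrier (line K). \<forall>n::nat. (\<lambda>i. cmod (s i \<ominus>\<^bsub>line K\<^esub> l)) \<longlonglongrightarrow> 0"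
    using lK sK by (intro bexI[of _ l]) (auto simp: line_minus line_simps)
qed

lemma banach_norm_cmod: "banach_norm K (line K) cmod"
  using seminorm_cmod induces_topology_cmod complete_cmod
  by (auto simp: banach_norm_def line_simps)

lemma frechet_line: "frechet_space K (line K)"
  unfolding frechet_space_def fundamental_system_def
  using module_line seminorm_cmod induces_topology_cmod complete_cmod
  by (intro conjI exI[of _ "\<lambda>_. cmod"]) (auto simp: separating_def line_simps)

lemma space_dist_line: "space_dist K (line K) dist"
  unfolding space_dist_def using banach_norm_cmod
  by (auto simp: line_simps line_minus dist_norm intro!: exI[of _ cmod])

lemma submodule_line: "submodule K (scalars K) (line K)"
  by (rule module.module_incl_imp_submodule[OF module_line])
    (use module_line in \<open>simp_all add: line_def\<close>)

definition scaling :: "(nat \<Rightarrow> nat set) \<Rightarrow> nat \<Rightarrow> nat \<Rightarrow> complex \<Rightarrow> complex set" where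
  "scaling E j k x = {(if k \<in> E j then of_nat k else 0) * x}"

lemma mlo_dom_scaling: "mlo_dom (line K) (scaling E j k) = K"
  by (simp add: mlo_dom_def scaling_def line_simps)

lemma mlo_scaling: "mlo K (line K) (line K) (scaling E j k)"
  unfolding mlo_def mlo_dom_scaling using submodule_line
  by (auto simp: scaling_def line_simps K_closed algebra_simps)

lemma mlo_setting_scaling: "mlo_setting K N (line K) (line K) dist K (scaling E)"
proof -
  have "K \<noteq> {0}"
    using K_closed(2) by auto
  then show ?thesis
    using frechet_line space_dist_line submodule_line mlo_scaling
    by (simp add: mlo_setting_def line_simps closedin_subtopology_refl)
qed

text \<open>The distance of the images of \<open>x\<close> and \<open>y\<close> is \<open>k * dist x y\<close> or \<open>0\<close>. It vanishes off \<open>E j\<close>,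
  and on \<open>E j\<close> it is at least \<open>dist x y\<close> and eventually exceeds \<open>1\<close>.\<close>

lemma dist_chaotic_scaling_iff:
  assumes N: "1 \<le> N"
  shows "dist_chaotic N (line K) dist K i (scaling E) \<longleftrightarrow> chaos_cond i N E (\<lambda>j. - E j)"
proof
  assume "dist_chaotic N (line K) dist K i (scaling E)"
  then obtain S and \<sigma> :: real where "uncountable S" and \<sigma>: "0 < \<sigma>"
    and chaos: "\<forall>\<epsilon>>0. \<forall>x\<in>S. \<forall>y\<in>S. x \<noteq> y \<longrightarrow>
      (\<exists>xs ys. (\<forall>j\<in>{1..N}. \<forall>k\<ge>1. xs j k \<in> scaling E j k x \<and> ys j k \<in> scaling E j k y) \<and>
        chaos_cond i N (\<lambda>j. {k. k \<ge> 1 \<and> dist (xs j k) (ys j k) \<ge> \<sigma>})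
          (\<lambda>j. {k. k \<ge> 1 \<and> dist (xs j k) (ys j k) < \<epsilon>}))"
    unfolding dist_chaotic_def by (elim exE conjE) (rule that)
  have "infinite S"
    using \<open>uncountable S\<close> countable_finite by blast
  then obtain x where x: "x \<in> S"
    using infinite_imp_nonempty by blast
  obtain y where y: "y \<in> S - {x}"
    using \<open>infinite S\<close> infinite_remove[of S x] infinite_imp_nonempty by blast
  have xy: "x \<in> S" "y \<in> S" "x \<noteq> y"
    using x y by auto
  \<comment> \<open>With \<open>\<epsilon> = dist x y\<close>, nearness at some \<open>k \<ge> 1\<close> already excludes \<open>k \<in> E j\<close>.\<close>
  have "0 < dist x y"
    using xy(3) by simp
  from chaos[rule_format, OF this xy] obtain xs ys
    where sel: "\<forall>j\<in>{1..N}. \<forall>k\<ge>1. xs j k \<in> scaling E j k x \<and> ys j k \<in> scaling E j k y"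
    and cond: "chaos_cond i N (\<lambda>j. {k. k \<ge> 1 \<and> dist (xs j k) (ys j k) \<ge> \<sigma>})
          (\<lambda>j. {k. k \<ge> 1 \<and> dist (xs j k) (ys j k) < dist x y})"
    by (elim exE conjE) (rule that)
  have d: "dist (xs j k) (ys j k) = (if k \<in> E j then real k * dist x y else 0)"
    if "j \<in> {1..N}" "1 \<le> k" for j k
    using sel[rule_format, OF that] by (auto simp: scaling_def dist_norm norm_mult simp flip: right_diff_distrib)
  show "chaos_cond i N E (\<lambda>j. - E j)"
  proof (rule chaos_cond_mono[OF cond])
    fix j assume j: "j \<in> {1..N}"
    show "{k. 1 \<le> k \<and> \<sigma> \<le> dist (xs j k) (ys j k)} \<subseteq> E j"
    proof
      fix k assume "k \<in> {k. 1 \<le> k \<and> \<sigma> \<le> dist (xs j k) (ys j k)}"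
      then show "k \<in> E j"
        using d[OF j, of k] \<sigma> by (auto split: if_splits)
    qed
    show "{k. 1 \<le> k \<and> dist (xs j k) (ys j k) < dist x y} \<subseteq> - E j"
    proof
      fix k assume k: "k \<in> {k. 1 \<le> k \<and> dist (xs j k) (ys j k) < dist x y}"
      then have "1 * dist x y \<le> real k * dist x y"
        by (intro mult_right_mono) auto
      then show "k \<in> - E j"
        using k d[OF j, of k] by (auto split: if_splits)
    qed
  qed
next
  assume cond: "chaos_cond i N E (\<lambda>j. - E j)"
  show "dist_chaotic N (line K) dist K i (scaling E)"
    unfolding dist_chaotic_def mlo_dom_scaling
  proof (rule exI[of _ K], rule exI[of _ 1], intro conjI allI impI ballI)
    show "uncountable K"
      by (rule uncountable_K)
    fix \<epsilon> :: real and x y assume \<epsilon>: "0 < \<epsilon>" and xy: "x \<in> K" "y \<in> K" "x \<noteq> y"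
    define im where "im = (\<lambda>z j k. (if k \<in> E j then of_nat k else 0) * z :: complex)"
    have d: "dist (im x j k) (im y j k) = (if k \<in> E j then real k * dist x y else 0)" for j k
      by (auto simp: im_def dist_norm norm_mult simp flip: right_diff_distrib)
    define m where "m = Suc (nat \<lceil>1 / dist x y\<rceil>)"
    have "1 / dist x y \<le> real m"
      unfolding m_def by linarith
    then have far: "1 \<le> real k * dist x y" if "m \<le> k" for k
      using that xy(3) by (simp add: divide_le_eq) (meson mult_right_mono of_nat_mono order.trans zero_le_dist)
    have pos: "1 \<le> k" if "m \<le> k" for k
      using that by (simp add: m_def)
    show "\<exists>xs ys. (\<forall>j\<in>{1..N}. \<forall>k\<ge>1. xs j k \<in> scaling E j k x \<and> ys j k \<in> scaling E j k y) \<and>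
        chaos_cond i N (\<lambda>j. {k. k \<ge> 1 \<and> dist (xs j k) (ys j k) \<ge> 1})
          (\<lambda>j. {k. k \<ge> 1 \<and> dist (xs j k) (ys j k) < \<epsilon>})"
    proof (rule exI[of _ "im x"], rule exI[of _ "im y"], rule conjI)
      show "\<forall>j\<in>{1..N}. \<forall>k\<ge>1. im x j k \<in> scaling E j k x \<and> im y j k \<in> scaling E j k y"
        by (simp add: im_def scaling_def)
      have "chaos_cond i N (\<lambda>j. E j \<inter> {m..}) (\<lambda>j. - E j \<inter> {m..})"
        using cond chaos_cond_atLeast[OF N] by simp
      then show "chaos_cond i N (\<lambda>j. {k. k \<ge> 1 \<and> dist (im x j k) (im y j k) \<ge> 1})
          (\<lambda>j. {k. k \<ge> 1 \<and> dist (im x j k) (im y j k) < \<epsilon>})"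
        by (rule chaos_cond_mono) (use far pos \<epsilon> in \<open>auto simp: d\<close>)
    qed
  qed (use N in auto)
qed

end

section \<open>The separating pattern\<close>

text \<open>The phase is constant on each interval from \<open>fact n\<close> to \<open>fact (n + 1)\<close>.\<close>

definition phase :: "nat \<Rightarrow> nat" where
  "phase m = (LEAST n. m < fact n) mod 3"

lemma phase_eq:
  assumes "fact n \<le> m" "m < fact (Suc n)"
  shows "phase m = Suc n mod 3"
proof -
  have "(LEAST n. m < fact n) = Suc n"
  proof (rule Least_equality)
    show "m < fact (Suc n)"
      by (rule assms(2))
    fix l assume "m < fact l"
    then show "Suc n \<le> l"
      using assms(1) fact_mono_nat[of l n] by (meson leD not_less_eq_eq order.trans)
  qed
  then show ?thesis
    by (simp add: phase_def)
qed

lemma upper_dens_phase: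
  assumes "t < 3"
  shows "upper_dens {k. phase (k div 2) = t} = 1"
proof (rule upper_dens_fact_blocks, unfold frequently_sequentially, intro allI)
  fix n0
  have "{2 * fact n..<2 * fact (Suc n)} \<subseteq> {k. phase (k div 2) = t}" if "Suc n mod 3 = t" for n
  proof
    fix k :: nat assume "k \<in> {2 * fact n..<2 * fact (Suc n)}"
    then have "fact n \<le> k div 2" "k div 2 < fact (Suc n)"
      by (auto simp del: fact_Suc)
    then show "k \<in> {k. phase (k div 2) = t}"
      using phase_eq that by auto
  qed
  moreover have "Suc (3 * n0 + t + 2) mod 3 = t"
    using assms by presburger
  moreover have "n0 \<le> 3 * n0 + t + 2"
    by simp
  ultimately show "\<exists>n\<ge>n0. {2 * fact n..<2 * fact (Suc n)} \<subseteq> {k. phase (k div 2) = t}"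
    by blast
qed

definition pattern :: "nat \<Rightarrow> nat set" where
  "pattern j =
     (if j = 1 then {k. odd k \<and> phase (k div 2) \<noteq> 1}
      else if j = 2 then {k. even k \<and> phase (k div 2) \<noteq> 2}
      else {})"

lemma pattern_union:
  assumes "2 \<le> N"
  shows "dens_union N pattern"
  unfolding dens_union_def
proof (rule upper_dens_1_mono[OF upper_dens_phase[of 0]])
  have "{k. phase (k div 2) = 0} \<subseteq> pattern 1 \<union> pattern 2"
    by (auto simp: pattern_def)
  also have "\<dots> \<subseteq> (\<Union>j\<in>{1..N}. pattern j)"
    using assms by (intro Un_least UN_upper) auto
  finally show "{k. phase (k div 2) = 0} \<subseteq> (\<Union>j\<in>{1..N}. pattern j)" .
qed simp

lemma pattern_not_ex: "\<not> dens_ex N pattern"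
proof -
  have "upper_dens (pattern j) \<le> ereal (1/2)" for j
    by (rule upper_dens_le_half) (auto simp: pattern_def)
  then have "upper_dens (pattern j) < 1" for j
    by (rule order.strict_trans1) (simp add: one_ereal_def)
  then show ?thesis
    by (metis dens_ex_def less_irrefl)
qed

lemma compl_pattern_all: "dens_all N (\<lambda>j. - pattern j)"
  unfolding dens_all_def
proof
  fix j :: nat
  define t where "t = (if j = 1 then 1 else 2 :: nat)"
  have "t < 3"
    by (simp add: t_def)
  then show "upper_dens (- pattern j) = 1"
    by (rule upper_dens_1_mono[OF upper_dens_phase]) (auto simp: pattern_def t_def)
qed

text \<open>If neither member of a pair lay in \<open>pattern 1 \<union> pattern 2\<close>, the pair would be both in phase 1
  and in phase 2.\<close>

lemma compl_pattern_not_inter: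
  assumes "2 \<le> N"
  shows "\<not> dens_inter N (\<lambda>j. - pattern j)"
proof -
  have "upper_dens (\<Inter>j\<in>{1..N}. - pattern j) \<le> upper_dens (- pattern 1 \<inter> - pattern 2)"
    using assms by (intro upper_dens_mono) auto
  also have "\<dots> \<le> ereal (1/2)"
    by (rule upper_dens_le_half) (auto simp: pattern_def)
  also have "\<dots> < 1"
    by (simp add: one_ereal_def)
  finally show ?thesis
    by (simp add: dens_inter_def)
qed

lemma chaos_cond_pattern_iff:
  assumes "2 \<le> N"
  shows "chaos_cond i N pattern (\<lambda>j. - pattern j) \<longleftrightarrow> i = 10"
    and "chaos_cond i N (\<lambda>j. - pattern j) pattern \<longleftrightarrow> i = 12"
proof -
  have "1 \<le> N"
    using assms by simp
  note facts = pattern_union[OF assms] pattern_not_ex[of N] compl_pattern_all[of N]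
    compl_pattern_not_inter[OF assms]
  have "\<not> dens_all N pattern" "\<not> dens_inter N pattern"
    using facts dens_imps[of N] \<open>1 \<le> N\<close> by blast+
  with facts show "chaos_cond i N pattern (\<lambda>j. - pattern j) \<longleftrightarrow> i = 10"
    and "chaos_cond i N (\<lambda>j. - pattern j) pattern \<longleftrightarrow> i = 12"
    unfolding chaos_cond_def by auto
qed

section \<open>Comparison of the twelve types\<close>

(* In the two non-implications the points of the spaces whose existence is claimed are taken from the type
   complex, as an underlying set of cardinality the continuum; carriers, operations, topologies
   and distances are all existentially quantified. *)
theorem proposition3p4:
  fixes K :: "complex set" and N :: nat
  assumes K: "K = \<real> \<or> K = UNIV" and N: "N \<ge> 2"
  shows
    "(\<forall>(X :: 'a tvs) (Y :: 'b tvs) d Xt A. mlo_setting K N X Y d Xt A \<longrightarrow>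
        (dist_chaotic N X d Xt 1 A \<longrightarrow> (\<forall>i\<in>{1..12}. dist_chaotic N X d Xt i A)) \<and>
        (dist_chaotic N X d Xt 2 A \<longrightarrow> (\<forall>i\<in>{3,4,5,6,10,11,12}. dist_chaotic N X d Xt i A)) \<and>
        (dist_chaotic N X d Xt 3 A \<longrightarrow> (\<forall>i\<in>{4,5,10,12}. dist_chaotic N X d Xt i A)) \<and>
        (dist_chaotic N X d Xt 4 A \<longrightarrow> dist_chaotic N X d Xt 12 A) \<and>
        (dist_chaotic N X d Xt 5 A \<longrightarrow> dist_chaotic N X d Xt 10 A) \<and>
        (dist_chaotic N X d Xt 6 A \<longrightarrow> (\<forall>i\<in>{4,11,12}. dist_chaotic N X d Xt i A)) \<and>
        (dist_chaotic N X d Xt 7 A \<longrightarrow> (\<forall>i\<in>{3,4,5,8,9,10,12}. dist_chaotic N X d Xt i A)) \<and>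
        (dist_chaotic N X d Xt 8 A \<longrightarrow> (\<forall>i\<in>{5,9,10}. dist_chaotic N X d Xt i A)) \<and>
        (dist_chaotic N X d Xt 9 A \<longrightarrow> dist_chaotic N X d Xt 10 A) \<and>
        (dist_chaotic N X d Xt 11 A \<longrightarrow> dist_chaotic N X d Xt 12 A)) \<and>
     (\<forall>i\<in>{1..12} - {10}. \<exists>(X :: complex tvs) (Y :: complex tvs) d Xt A.
        mlo_setting K N X Y d Xt A \<and> dist_chaotic N X d Xt 10 A \<and> \<not> dist_chaotic N X d Xt i A) \<and>
     (\<forall>i\<in>{1..12} - {12}. \<exists>(X :: complex tvs) (Y :: complex tvs) d Xt A.
        mlo_setting K N X Y d Xt A \<and> dist_chaotic N X d Xt 12 A \<and> \<not> dist_chaotic N X d Xt i A)"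
proof (intro conjI)
  have N1: "1 \<le> N"
    using N by simp
  note imps = dens_inter_imp_all[of N] dens_all_imp_ex[OF N1] dens_ex_imp_union[of N]
  have twelve: "{1..12} = {1, 2, 3, 4, 5, 6, 7, 8, 9, 10, 11, 12 :: nat}"
    by (auto simp: numeral_eq_Suc le_Suc_eq)
  show "\<forall>(X :: 'a tvs) (Y :: 'b tvs) d Xt A. mlo_setting K N X Y d Xt A \<longrightarrow>
        (dist_chaotic N X d Xt 1 A \<longrightarrow> (\<forall>i\<in>{1..12}. dist_chaotic N X d Xt i A)) \<and>
        (dist_chaotic N X d Xt 2 A \<longrightarrow> (\<forall>i\<in>{3,4,5,6,10,11,12}. dist_chaotic N X d Xt i A)) \<and>
        (dist_chaotic N X d Xt 3 A \<longrightarrow> (\<forall>i\<in>{4,5,10,12}. dist_chaotic N X d Xt i A)) \<and>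
        (dist_chaotic N X d Xt 4 A \<longrightarrow> dist_chaotic N X d Xt 12 A) \<and>
        (dist_chaotic N X d Xt 5 A \<longrightarrow> dist_chaotic N X d Xt 10 A) \<and>
        (dist_chaotic N X d Xt 6 A \<longrightarrow> (\<forall>i\<in>{4,11,12}. dist_chaotic N X d Xt i A)) \<and>
        (dist_chaotic N X d Xt 7 A \<longrightarrow> (\<forall>i\<in>{3,4,5,8,9,10,12}. dist_chaotic N X d Xt i A)) \<and>
        (dist_chaotic N X d Xt 8 A \<longrightarrow> (\<forall>i\<in>{5,9,10}. dist_chaotic N X d Xt i A)) \<and>
        (dist_chaotic N X d Xt 9 A \<longrightarrow> dist_chaotic N X d Xt 10 A) \<and>
        (dist_chaotic N X d Xt 11 A \<longrightarrow> dist_chaotic N X d Xt 12 A)"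
    unfolding twelve ball_simps
    by (intro allI impI conjI TrueI; erule dist_chaotic_weaken; auto simp: chaos_cond_def intro: imps)
  interpret scalar_field K
    by unfold_locales (rule K)
  show "\<forall>i\<in>{1..12} - {10}. \<exists>(X :: complex tvs) (Y :: complex tvs) d Xt A.
        mlo_setting K N X Y d Xt A \<and> dist_chaotic N X d Xt 10 A \<and> \<not> dist_chaotic N X d Xt i A"
    using mlo_setting_scaling[of N pattern] dist_chaotic_scaling_iff[OF N1, of _ pattern]
      chaos_cond_pattern_iff(1)[OF N] by blast
  show "\<forall>i\<in>{1..12} - {12}. \<exists>(X :: complex tvs) (Y :: complex tvs) d Xt A.
        mlo_setting K N X Y d Xt A \<and> dist_chaotic N X d Xt 12 A \<and> \<not> dist_chaotic N X d Xt i A"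
    using mlo_setting_scaling[of N "\<lambda>j. - pattern j"]
      dist_chaotic_scaling_iff[OF N1, of _ "\<lambda>j. - pattern j", unfolded double_complement]
      chaos_cond_pattern_iff(2)[OF N] by blast
qed

end
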